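(* Let $G$ be a linear algebraic group over an algebraically closed field $\Bbbk$ of arbitrary characteristic. Suppose $G$ contains a non-trivial torus. Then $\sigma(G)=\infty$.
   Context: A $G$-module is a finite-dimensional rational representation $V$ of $G$ over $\Bbbk$. $\Bbbk[V]\cong S(V^* )$ is the ring of polynomial functions on $V$, with $G$-action $(g\cdot f)(v)=f(g^{-1}v)$ and invariant ring $\Bbbk[V]^G$, graded by degree. $\Bbbk[V]^G_{\le d}$ is the set of invariants of degree at most $d$. For $S\subseteq \Bbbk[V]$, $S_+$ is the set of elements of $S$ with constant term zero. The nullcone $\mathcal{N}_{G,V}\subseteq V$ is the common zero set of $\Bbbk[V]^G_+$. A subset $S\subseteq\Bbbk[V]^G$ is a $\sigma$-set if for every $v\in V\setminus\mathcal{N}_{G,V}$ there is $f\in S_+$ with $f(v)\neq 0$. Define $\sigma(G,V)=\min\{d\ge 0 : \Bbbk[V]^G_{\le d}\text{ is a }\sigma\text{-set}\}$ and $\sigma(G)=\sup\{\sigma(G,V): V\text{ a }G\text{-module}\}$ (equal to $\infty$ if unbounded). *)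

theory Defs
  imports
    "Jordan_Normal_Form.Determinant"
    "HOL-Algebra.Group"
    "HOL-Library.Poly_Mapping"
    "HOL-Library.Extended_Nat"
begin

section \<open>Polynomials in several variables\<close>

type_synonym ('i, 'k) mpoly = "('i \<Rightarrow>\<^sub>0 nat) \<Rightarrow>\<^sub>0 'k"

definition mpoly_eval :: "('i \<Rightarrow> 'k) \<Rightarrow> ('i, 'k::comm_semiring_1) mpoly \<Rightarrow> 'k" where
  "mpoly_eval x p =
     (\<Sum>\<alpha>\<in>Poly_Mapping.keys p. Poly_Mapping.lookup p \<alpha> *
        (\<Prod>i\<in>Poly_Mapping.keys \<alpha>. x i ^ Poly_Mapping.lookup \<alpha> i))"

definition mpoly_vars :: "('i, 'k::zero) mpoly \<Rightarrow> 'i set" where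
  "mpoly_vars p = (\<Union>\<alpha>\<in>Poly_Mapping.keys p. Poly_Mapping.keys \<alpha>)"

text \<open>The zero polynomial gets degree 0.\<close>

definition mpoly_degree :: "('i, 'k::zero) mpoly \<Rightarrow> nat" where
  "mpoly_degree p =
     Max (insert 0 ((\<lambda>\<alpha>. \<Sum>i\<in>Poly_Mapping.keys \<alpha>. Poly_Mapping.lookup \<alpha> i) ` Poly_Mapping.keys p))"

definition mpoly_const_term :: "('i, 'k::zero) mpoly \<Rightarrow> 'k" where
  "mpoly_const_term p = Poly_Mapping.lookup p 0"


section \<open>Linear algebraic groups\<close>

definition GL :: "nat \<Rightarrow> 'k::field mat monoid" where
  "GL n = units_of (ring_mat TYPE('k) n ())"

lemma group_GL: "group (GL n :: 'k::field mat monoid)"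
proof -
  interpret ring "ring_mat TYPE('k) n ()" by (rule ring_mat)
  show ?thesis unfolding GL_def by (rule units_group)
qed

lemma carrier_GL:
  "carrier (GL n) = {A :: 'k::field mat. A \<in> carrier_mat n n \<and> det A \<noteq> 0}"
proof (intro Set.set_eqI iffI)
  fix A :: "'k mat"
  assume "A \<in> carrier (GL n)"
  then have A: "A \<in> Units (ring_mat TYPE('k) n ())" by (simp add: GL_def units_of_carrier)
  then have "A \<in> carrier_mat n n" by (simp add: Units_def ring_mat_def)
  with unit_imp_det_non_zero[OF A]
  show "A \<in> {A. A \<in> carrier_mat n n \<and> det A \<noteq> 0}" by simp
next
  fix A :: "'k mat"
  assume "A \<in> {A. A \<in> carrier_mat n n \<and> det A \<noteq> 0}"
  then show "A \<in> carrier (GL n)"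
    by (simp add: GL_def units_of_carrier det_non_zero_imp_unit)
qed

text \<open>
  A polynomial in the entries of an \<open>n \<times> n\<close> matrix has its variables indexed by
  \<open>{..<n} \<times> {..<n}\<close>.  The open subvariety \<open>GL n\<close> of the space of all matrices carries the
  subspace topology, so its closed subsets are cut out by such polynomials.
\<close>

definition zariski_closed_in_GL :: "nat \<Rightarrow> 'k::field mat set \<Rightarrow> bool" where
  "zariski_closed_in_GL n X \<longleftrightarrow>
     (\<exists>P. (\<forall>p\<in>P. mpoly_vars p \<subseteq> {..<n} \<times> {..<n}) \<and>
          X = {A \<in> carrier (GL n). \<forall>p\<in>P. mpoly_eval (($$) A) p = 0})"

definition linear_algebraic_group :: "nat \<Rightarrow> 'k::field mat set \<Rightarrow> bool" where
  "linear_algebraic_group n G \<longleftrightarrow> subgroup G (GL n) \<and> zariski_closed_in_GL n G"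

text \<open>
  The coordinate ring of a closed subset of \<open>GL n\<close> consists of the restrictions of the elements
  of the localization \<open>k[x\<^sub>i\<^sub>j][1/det]\<close>.
\<close>

definition regular_on :: "nat \<Rightarrow> 'k::field mat set \<Rightarrow> ('k mat \<Rightarrow> 'k) \<Rightarrow> bool" where
  "regular_on n G f \<longleftrightarrow>
     (\<exists>p N. mpoly_vars p \<subseteq> {..<n} \<times> {..<n} \<and>
            (\<forall>A\<in>G. f A = mpoly_eval (($$) A) p / det A ^ N))"

text \<open>
  As \<open>GL m\<close> is open in the affine space of all matrices, a map into a closed subset of \<open>GL m\<close>
  is a morphism of varieties iff its matrix entries are regular functions.
\<close>

definition algebraic_group_hom ::
    "nat \<Rightarrow> 'k::field mat set \<Rightarrow> nat \<Rightarrow> 'k mat set \<Rightarrow> ('k mat \<Rightarrow> 'k mat) \<Rightarrow> bool" where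
  "algebraic_group_hom n G m H \<phi> \<longleftrightarrow>
     \<phi> \<in> hom (GL n\<lparr>carrier := G\<rparr>) (GL m\<lparr>carrier := H\<rparr>) \<and>
     (\<forall>i<m. \<forall>j<m. regular_on n G (\<lambda>A. \<phi> A $$ (i, j)))"

definition algebraic_group_isomorphic ::
    "nat \<Rightarrow> 'k::field mat set \<Rightarrow> nat \<Rightarrow> 'k mat set \<Rightarrow> bool" where
  "algebraic_group_isomorphic n G m H \<longleftrightarrow>
     (\<exists>\<phi> \<psi>. algebraic_group_hom n G m H \<phi> \<and> algebraic_group_hom m H n G \<psi> \<and>
            (\<forall>A\<in>G. \<psi> (\<phi> A) = A) \<and> (\<forall>B\<in>H. \<phi> (\<psi> B) = B))"

text \<open>The standard torus of rank \<open>r\<close>, i.e. the \<open>r\<close>-fold power of the multiplicative group.\<close>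

definition diagonal_group :: "nat \<Rightarrow> 'k::field mat set" where
  "diagonal_group r = {A \<in> carrier (GL r). diagonal_mat A}"

definition is_torus :: "nat \<Rightarrow> 'k::field mat set \<Rightarrow> bool" where
  "is_torus n T \<longleftrightarrow>
     linear_algebraic_group n T \<and> (\<exists>r. algebraic_group_isomorphic n T r (diagonal_group r))"


section \<open>Modules and invariants\<close>

text \<open>
  After a choice of basis a finite-dimensional rational representation is a homomorphism of
  algebraic groups \<open>\<rho>\<close> from \<open>G\<close> to \<open>GL m\<close>; the underlying space is then \<open>carrier_vec m\<close>.
\<close>

definition is_module :: "nat \<Rightarrow> 'k::field mat set \<Rightarrow> nat \<Rightarrow> ('k mat \<Rightarrow> 'k mat) \<Rightarrow> bool" where
  "is_module n G m \<rho> \<longleftrightarrow> algebraic_group_hom n G m (carrier (GL m)) \<rho>"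

text \<open>
  Over an infinite field (in particular an algebraically closed one) polynomials in \<open>m\<close> variables
  can be identified with polynomial functions on \<open>carrier_vec m\<close>.
\<close>

definition coord_ring :: "nat \<Rightarrow> (nat, 'k::field) mpoly set" where
  "coord_ring m = {f. mpoly_vars f \<subseteq> {..<m}}"

abbreviation poly_fun :: "(nat, 'k::field) mpoly \<Rightarrow> 'k vec \<Rightarrow> 'k" where
  "poly_fun f v \<equiv> mpoly_eval (($) v) f"

definition act_fun ::
    "nat \<Rightarrow> ('k::field mat \<Rightarrow> 'k mat) \<Rightarrow> 'k mat \<Rightarrow> ('k vec \<Rightarrow> 'k) \<Rightarrow> 'k vec \<Rightarrow> 'k" where
  "act_fun n \<rho> g F = (\<lambda>v. F (\<rho> (inv\<^bsub>GL n\<^esub> g) *\<^sub>v v))"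

definition invariants ::
    "nat \<Rightarrow> 'k::field mat set \<Rightarrow> nat \<Rightarrow> ('k mat \<Rightarrow> 'k mat) \<Rightarrow> (nat, 'k) mpoly set" where
  "invariants n G m \<rho> =
     {f \<in> coord_ring m. \<forall>g\<in>G. \<forall>v\<in>carrier_vec m. act_fun n \<rho> g (poly_fun f) v = poly_fun f v}"

definition invariants_le ::
    "nat \<Rightarrow> 'k::field mat set \<Rightarrow> nat \<Rightarrow> ('k mat \<Rightarrow> 'k mat) \<Rightarrow> nat \<Rightarrow> (nat, 'k) mpoly set" where
  "invariants_le n G m \<rho> d = {f \<in> invariants n G m \<rho>. mpoly_degree f \<le> d}"

definition plus_part :: "(nat, 'k::field) mpoly set \<Rightarrow> (nat, 'k) mpoly set" where
  "plus_part S = {f \<in> S. mpoly_const_term f = 0}"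

definition nullcone ::
    "nat \<Rightarrow> 'k::field mat set \<Rightarrow> nat \<Rightarrow> ('k mat \<Rightarrow> 'k mat) \<Rightarrow> 'k vec set" where
  "nullcone n G m \<rho> =
     {v \<in> carrier_vec m. \<forall>f\<in>plus_part (invariants n G m \<rho>). poly_fun f v = 0}"


section \<open>The numbers \<open>\<sigma>(G,V)\<close> and \<open>\<sigma>(G)\<close>\<close>

definition sigma_set ::
    "nat \<Rightarrow> 'k::field mat set \<Rightarrow> nat \<Rightarrow> ('k mat \<Rightarrow> 'k mat) \<Rightarrow> (nat, 'k) mpoly set \<Rightarrow> bool" where
  "sigma_set n G m \<rho> S \<longleftrightarrow>
     S \<subseteq> invariants n G m \<rho> \<and>
     (\<forall>v\<in>carrier_vec m - nullcone n G m \<rho>. \<exists>f\<in>plus_part S. poly_fun f v \<noteq> 0)"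

text \<open>
  The infimum below is over a set that is nonempty by Hilbert's basis theorem (the nullcone is the
  zero set of finitely many invariants), hence it is a minimum.
\<close>

definition sigma_module ::
    "nat \<Rightarrow> 'k::field mat set \<Rightarrow> nat \<Rightarrow> ('k mat \<Rightarrow> 'k mat) \<Rightarrow> enat" where
  "sigma_module n G m \<rho> = Inf {enat d | d. sigma_set n G m \<rho> (invariants_le n G m \<rho> d)}"

definition sigma_group :: "nat \<Rightarrow> 'k::field mat set \<Rightarrow> enat" where
  "sigma_group n G = Sup {sigma_module n G m \<rho> | m \<rho>. is_module n G m \<rho>}"

end

theory Submission
  imports Defs
begin

text \<open>
  Let \<open>U\<close> be the natural module of \<open>G \<subseteq> GL n\<close>.  A non-trivial torus in \<open>G\<close> contains a non-trivial
  one-parameter subgroup; expanding it in powers of the parameter, the coefficient matrices are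
  orthogonal idempotents, and a non-zero one of non-zero weight provides \<open>u \<in> U\<close> and \<open>l \<in> U\<^sup>*\<close> with
  \<open>l(u) \<noteq> 0\<close> such that every \<open>s \<noteq> 0\<close> is attained as a common eigenvalue \<open>A u = s u\<close>, \<open>l A = s l\<close>
  for some \<open>A \<in> G\<close>.

  On the module \<open>U \<oplus> (U\<^sup>*)\<^bsup>\<otimes>k\<^esup>\<close> the map \<open>(x, w) \<mapsto> w(x, \<dots>, x)\<close> is an invariant that does not vanish at
  \<open>v = (u, l \<otimes> \<dots> \<otimes> l)\<close>.  The orbit of \<open>v\<close> contains all \<open>(s u, s\<^sup>-\<^sup>k l \<otimes> \<dots> \<otimes> l)\<close>, so only monomials of
  bidegree \<open>(k b, b)\<close> contribute to the value of an invariant at \<open>v\<close>; in degree at most \<open>k\<close> this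
  leaves the constant term.  Hence \<open>\<sigma>(G, V) > k\<close>.
\<close>

section \<open>Permutation bounds and polynomial identities over an infinite field\<close>

lemma permutes_nat_less: "\<pi> permutes {0..<m} \<Longrightarrow> a < m \<Longrightarrow> \<pi> a < (m :: nat)"
  using permutes_in_image[of \<pi> "{0..<m}" a] by simp

text \<open>Over a finite field the product of all X - a vanishes everywhere, so adding 1 to it
  gives a polynomial of positive degree without a root.\<close>

lemma infinite_UNIV_alg_closed: "infinite (UNIV :: 'k::alg_closed_field set)"
proof
  assume fin: "finite (UNIV :: 'k set)"
  define p :: "'k poly" where "p = (\<Prod>a\<in>UNIV. [:- a, 1:])"
  have "degree p = card (UNIV :: 'k set)"
    unfolding p_def by (subst degree_prod_eq_sum_degree) auto
  then have "degree (p + 1) > 0"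
    using fin by (subst degree_add_eq_left) (auto simp: card_gt_0_iff)
  then obtain x where "poly (p + 1) x = 0" using alg_closed_imp_poly_has_root by blast
  moreover have "poly p x = 0" using fin by (auto simp: p_def poly_prod)
  ultimately show False by simp
qed

text \<open>Identities along a one-parameter subgroup are available only for nonzero parameters;
  since the field is infinite, these already determine all coefficients.\<close>

lemma poly_eqI_nonzero:
  fixes p q :: "'k::alg_closed_field poly"
  assumes "\<And>x. x \<noteq> 0 \<Longrightarrow> poly p x = poly q x"
  shows "p = q"
proof (rule ccontr)
  assume "p \<noteq> q"
  then have "finite {x. poly (p - q) x = 0}" by (intro poly_roots_finite) auto
  moreover have "UNIV - {0} \<subseteq> {x. poly (p - q) x = 0}" using assms by auto
  ultimately have "finite (UNIV - {0 :: 'k})" by (rule rev_finite_subset)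
  with infinite_UNIV_alg_closed[where 'k = 'k] show False by simp
qed

lemma coeff_eq_if_poly_eq_nonzero:
  fixes p q :: "'k::alg_closed_field poly"
  assumes "\<And>x. x \<noteq> 0 \<Longrightarrow> poly p x = poly q x"
  shows "coeff p i = coeff q i"
  using poly_eqI_nonzero[OF assms] by simp

subsection \<open>Polynomial functions\<close>

definition monomial_eval :: "('i \<Rightarrow> 'k) \<Rightarrow> ('i \<Rightarrow>\<^sub>0 nat) \<Rightarrow> 'k::comm_semiring_1" where
  "monomial_eval x \<alpha> = (\<Prod>i\<in>Poly_Mapping.keys \<alpha>. x i ^ Poly_Mapping.lookup \<alpha> i)"

text \<open>Indices outside the support contribute the factor 1, so exponents with different
  supports can be handled over one common index set.\<close>

lemma monomial_eval_superset:
  assumes "finite I" "Poly_Mapping.keys \<alpha> \<subseteq> I"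
  shows "monomial_eval x \<alpha> = (\<Prod>i\<in>I. x i ^ Poly_Mapping.lookup \<alpha> i)"
  unfolding monomial_eval_def using assms
  by (intro prod.mono_neutral_left) (auto simp: in_keys_iff)

lemma monomial_eval_add: "monomial_eval x (\<alpha> + \<beta>) = monomial_eval x \<alpha> * monomial_eval x \<beta>"
proof -
  let ?I = "Poly_Mapping.keys \<alpha> \<union> Poly_Mapping.keys \<beta>"
  have "monomial_eval x (\<alpha> + \<beta>) = (\<Prod>i\<in>?I. x i ^ Poly_Mapping.lookup (\<alpha> + \<beta>) i)"
    using keys_add[of \<alpha> \<beta>] by (intro monomial_eval_superset) auto
  also have "\<dots> = (\<Prod>i\<in>?I. x i ^ Poly_Mapping.lookup \<alpha> i) * (\<Prod>i\<in>?I. x i ^ Poly_Mapping.lookup \<beta> i)"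
    by (simp add: lookup_add power_add prod.distrib)
  also have "\<dots> = monomial_eval x \<alpha> * monomial_eval x \<beta>"
    by (simp add: monomial_eval_superset[symmetric])
  finally show ?thesis .
qed

lemma mpoly_eval_superset:
  assumes "finite K" "Poly_Mapping.keys p \<subseteq> K"
  shows "mpoly_eval x p = (\<Sum>\<alpha>\<in>K. Poly_Mapping.lookup p \<alpha> * monomial_eval x \<alpha>)"
  unfolding mpoly_eval_def monomial_eval_def using assms
  by (intro sum.mono_neutral_left) (auto simp: in_keys_iff)

lemma mpoly_eval_alt:
  "mpoly_eval x p = (\<Sum>\<alpha>\<in>Poly_Mapping.keys p. Poly_Mapping.lookup p \<alpha> * monomial_eval x \<alpha>)"
  by (rule mpoly_eval_superset) auto

lemma mpoly_eval_add: "mpoly_eval x (p + q) = mpoly_eval x p + mpoly_eval x q"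
proof -
  let ?K = "Poly_Mapping.keys p \<union> Poly_Mapping.keys q"
  have "mpoly_eval x (p + q) = (\<Sum>\<alpha>\<in>?K. Poly_Mapping.lookup (p + q) \<alpha> * monomial_eval x \<alpha>)"
    using keys_add[of p q] by (intro mpoly_eval_superset) auto
  also have "\<dots> = (\<Sum>\<alpha>\<in>?K. Poly_Mapping.lookup p \<alpha> * monomial_eval x \<alpha>)
      + (\<Sum>\<alpha>\<in>?K. Poly_Mapping.lookup q \<alpha> * monomial_eval x \<alpha>)"
    by (simp add: lookup_add distrib_right sum.distrib)
  also have "\<dots> = mpoly_eval x p + mpoly_eval x q"
    by (simp add: mpoly_eval_superset[symmetric])
  finally show ?thesis .
qed

lemma mpoly_eval_single: "mpoly_eval x (Poly_Mapping.single \<alpha> c) = c * monomial_eval x \<alpha>"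
  by (subst mpoly_eval_superset[of "{\<alpha>}"]) (auto simp: lookup_single)

text \<open>At the origin every monomial except 1 vanishes. This reads off the constant term of a
  polynomial that is known only through its values.\<close>

lemma mpoly_eval_0:
  fixes p :: "('i, 'k::comm_semiring_1) mpoly"
  shows "mpoly_eval (\<lambda>_. 0) p = mpoly_const_term p"
proof -
  have "monomial_eval (\<lambda>_. 0 :: 'k) \<alpha> = (if \<alpha> = 0 then 1 else 0)" for \<alpha> :: "'i \<Rightarrow>\<^sub>0 nat"
  proof (cases "\<alpha> = 0")
    case False
    then obtain i where "i \<in> Poly_Mapping.keys \<alpha>" by fastforce
    then have "(\<Prod>i\<in>Poly_Mapping.keys \<alpha>. (0 :: 'k) ^ Poly_Mapping.lookup \<alpha> i) = 0"
      by (intro prod_zero) (auto simp: in_keys_iff power_0_left intro!: bexI[of _ i])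
    with False show ?thesis by (simp add: monomial_eval_def)
  qed (simp add: monomial_eval_def)
  then have *: "c * monomial_eval (\<lambda>_. 0 :: 'k) \<alpha> = (if 0 = \<alpha> then c else 0)"
    for c and \<alpha> :: "'i \<Rightarrow>\<^sub>0 nat"
    by auto
  show ?thesis
    by (subst mpoly_eval_superset[of "insert 0 (Poly_Mapping.keys p)"])
       (auto simp: * mpoly_const_term_def sum.delta')
qed

lemma mpoly_eval_cong:
  assumes "\<And>i. i \<in> mpoly_vars p \<Longrightarrow> x i = y i"
  shows "mpoly_eval x p = mpoly_eval y p"
  unfolding mpoly_eval_def using assms
  by (intro sum.cong arg_cong2[of _ _ _ _ "(*)"] prod.cong arg_cong2[of _ _ _ _ "(^)"])
     (auto simp: mpoly_vars_def)

lemma mpoly_vars_add: "mpoly_vars (p + q) \<subseteq> mpoly_vars p \<union> mpoly_vars q"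
proof -
  have "mpoly_vars (p + q) \<subseteq> (\<Union>\<alpha>\<in>Poly_Mapping.keys p \<union> Poly_Mapping.keys q. Poly_Mapping.keys \<alpha>)"
    unfolding mpoly_vars_def by (intro UN_mono keys_add subset_refl)
  then show ?thesis by (simp add: mpoly_vars_def UN_Un)
qed

text \<open>A view of polynomials at the level of functions: closure rules for sums and products
  replace the explicit construction of coefficient maps.\<close>

definition polynomial_in :: "'i set \<Rightarrow> (('i \<Rightarrow> 'k) \<Rightarrow> 'k::comm_semiring_1) \<Rightarrow> bool" where
  "polynomial_in I F \<longleftrightarrow> (\<exists>p. mpoly_vars p \<subseteq> I \<and> (\<forall>x. F x = mpoly_eval x p))"

lemma polynomial_in_monomial:
  assumes "Poly_Mapping.keys \<alpha> \<subseteq> I"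
  shows "polynomial_in I (\<lambda>x. c * monomial_eval x \<alpha>)"
  unfolding polynomial_in_def using assms
  by (intro exI[of _ "Poly_Mapping.single \<alpha> c"])
     (auto simp: mpoly_eval_single mpoly_vars_def split: if_splits)

lemma polynomial_in_const: "polynomial_in I (\<lambda>x. c)"
  using polynomial_in_monomial[of 0 I c] by (simp add: monomial_eval_def)

lemma polynomial_in_var:
  assumes "i \<in> I"
  shows "polynomial_in I (\<lambda>x. x i)"
  using polynomial_in_monomial[of "Poly_Mapping.single i 1" I 1] assms
  by (simp add: monomial_eval_def)

lemma polynomial_in_add:
  assumes "polynomial_in I F" "polynomial_in I F'"
  shows "polynomial_in I (\<lambda>x. F x + F' x)"
proof -
  obtain p q where "mpoly_vars p \<subseteq> I" "mpoly_vars q \<subseteq> I"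
    "\<And>x. F x = mpoly_eval x p" "\<And>x. F' x = mpoly_eval x q"
    using assms by (auto simp: polynomial_in_def)
  moreover from this have "mpoly_vars (p + q) \<subseteq> I"
    using mpoly_vars_add[of p q] by blast
  ultimately show ?thesis
    unfolding polynomial_in_def by (intro exI[of _ "p + q"]) (auto simp: mpoly_eval_add)
qed

lemma polynomial_in_sum:
  assumes "\<And>a. a \<in> S \<Longrightarrow> polynomial_in I (F a)"
  shows "polynomial_in I (\<lambda>x. \<Sum>a\<in>S. F a x)"
  using assms
  by (induction S rule: infinite_finite_induct) (auto intro: polynomial_in_const polynomial_in_add)

lemma polynomial_in_mult:
  assumes "polynomial_in I F" "polynomial_in I F'"
  shows "polynomial_in I (\<lambda>x. F x * F' x)"
proof -
  obtain p q where pq: "mpoly_vars p \<subseteq> I" "mpoly_vars q \<subseteq> I"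
    and F: "\<And>x. F x = mpoly_eval x p" "\<And>x. F' x = mpoly_eval x q"
    using assms by (auto simp: polynomial_in_def)
  \<comment> \<open>The product is expanded into terms
    \<open>c * monomial_eval x (\<alpha> + \<beta>)\<close>, so the rules for sums and monomials
    apply to it.\<close>
  have "F x * F' x = (\<Sum>\<alpha>\<in>Poly_Mapping.keys p. \<Sum>\<beta>\<in>Poly_Mapping.keys q.
      Poly_Mapping.lookup p \<alpha> * Poly_Mapping.lookup q \<beta> * monomial_eval x (\<alpha> + \<beta>))" for x
    by (simp add: F mpoly_eval_alt sum_product monomial_eval_add mult_ac)
  moreover have "Poly_Mapping.keys (\<alpha> + \<beta>) \<subseteq> I"
    if "\<alpha> \<in> Poly_Mapping.keys p" "\<beta> \<in> Poly_Mapping.keys q" for \<alpha> \<beta>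
  proof -
    have "Poly_Mapping.keys \<alpha> \<subseteq> mpoly_vars p" "Poly_Mapping.keys \<beta> \<subseteq> mpoly_vars q"
      using that by (auto simp: mpoly_vars_def)
    then show ?thesis using pq keys_add[of \<alpha> \<beta>] by blast
  qed
  ultimately show ?thesis
    by (auto intro!: polynomial_in_sum polynomial_in_monomial)
qed

lemma polynomial_in_prod:
  assumes "\<And>a. a \<in> S \<Longrightarrow> polynomial_in I (F a)"
  shows "polynomial_in I (\<lambda>x. \<Prod>a\<in>S. F a x)"
  using assms
  by (induction S rule: infinite_finite_induct) (auto intro: polynomial_in_const polynomial_in_mult)

text \<open>Restricting a polynomial to a polynomially parametrised curve gives a polynomial in the
  parameter; this is needed for the curve diag(t, 1, ..., 1).\<close>

lemma mpoly_eval_poly: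
  fixes p :: "('i, 'k::field) mpoly"
  shows "\<exists>P. \<forall>t. poly P t = mpoly_eval (\<lambda>i. poly (q i) t) p"
  by (intro exI[of _ "\<Sum>\<alpha>\<in>Poly_Mapping.keys p. smult (Poly_Mapping.lookup p \<alpha>)
      (\<Prod>i\<in>Poly_Mapping.keys \<alpha>. q i ^ Poly_Mapping.lookup \<alpha> i)"])
     (simp add: mpoly_eval_def poly_sum poly_prod)

subsection \<open>Regular functions\<close>

lemma regular_on_polynomial:
  assumes "polynomial_in ({..<n} \<times> {..<n}) F" "\<And>A. A \<in> G \<Longrightarrow> f A = F (($$) A)"
  shows "regular_on n G f"
proof -
  obtain p where "mpoly_vars p \<subseteq> {..<n} \<times> {..<n}" "\<And>x. F x = mpoly_eval x p"
    using assms(1) by (auto simp: polynomial_in_def)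
  with assms(2) show ?thesis
    unfolding regular_on_def by (intro exI[of _ p] exI[of _ 0]) auto
qed

lemma regular_on_const: "regular_on n G (\<lambda>A. c)"
  by (rule regular_on_polynomial[OF polynomial_in_const]) simp

lemma regular_on_entry: "i < n \<Longrightarrow> j < n \<Longrightarrow> regular_on n G (\<lambda>A. A $$ (i, j))"
  by (rule regular_on_polynomial[OF polynomial_in_var[of "(i, j)"]]) auto

lemma regular_on_mult:
  assumes "regular_on n G f" "regular_on n G g"
  shows "regular_on n G (\<lambda>A. f A * g A)"
proof -
  obtain p N q M where p: "mpoly_vars p \<subseteq> {..<n} \<times> {..<n}" "mpoly_vars q \<subseteq> {..<n} \<times> {..<n}"
    and fg: "\<And>A. A \<in> G \<Longrightarrow> f A = mpoly_eval (($$) A) p / det A ^ N"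
      "\<And>A. A \<in> G \<Longrightarrow> g A = mpoly_eval (($$) A) q / det A ^ M"
    using assms unfolding regular_on_def by metis
  have "polynomial_in ({..<n} \<times> {..<n}) (\<lambda>x. mpoly_eval x p * mpoly_eval x q)"
    using p by (intro polynomial_in_mult) (auto simp: polynomial_in_def)
  then obtain r where "mpoly_vars r \<subseteq> {..<n} \<times> {..<n}"
    "\<And>x. mpoly_eval x p * mpoly_eval x q = mpoly_eval x r"
    by (auto simp: polynomial_in_def)
  with fg show ?thesis
    unfolding regular_on_def by (intro exI[of _ r] exI[of _ "N + M"]) (auto simp: power_add)
qed

lemma regular_on_prod:
  assumes "\<And>a. a \<in> S \<Longrightarrow> regular_on n G (f a)"
  shows "regular_on n G (\<lambda>A. \<Prod>a\<in>S. f a A)"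
  using assms
  by (induction S rule: infinite_finite_induct) (auto intro: regular_on_const regular_on_mult)

lemma regular_on_cong:
  assumes "\<And>A. A \<in> G \<Longrightarrow> f A = g A" "regular_on n G f"
  shows "regular_on n G g"
  using assms by (simp add: regular_on_def)

text \<open>By Cramer's rule these quotients are the entries of the inverse transpose, so the
  contragredient action will be rational.\<close>

lemma regular_on_cofactor_div_det:
  assumes G: "G \<subseteq> carrier_mat n n" and ij: "i < n" "j < n"
  shows "regular_on n G (\<lambda>A. cofactor A i j / det A)"
proof -
  \<comment> \<open>The Leibniz formula for the minor, written in the entries of the full matrix:
    \<open>insert_index\<close> skips row \<open>i\<close> and column \<open>j\<close>.\<close>
  define F :: "(nat \<times> nat \<Rightarrow> 'a) \<Rightarrow> 'a" where
    "F = (\<lambda>x. (- 1) ^ (i + j) * (\<Sum>\<pi> | \<pi> permutes {0..<n - 1}.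
      signof \<pi> * (\<Prod>a = 0..<n - 1. x (insert_index i a, insert_index j (\<pi> a)))))"
  have "polynomial_in ({..<n} \<times> {..<n}) F"
    unfolding F_def
    by (intro polynomial_in_mult polynomial_in_sum polynomial_in_prod polynomial_in_const
        polynomial_in_var)
       (use ij in \<open>auto simp: insert_index_def dest: permutes_nat_less\<close>)
  then obtain p where p: "mpoly_vars p \<subseteq> {..<n} \<times> {..<n}" "\<And>x. F x = mpoly_eval x p"
    by (auto simp: polynomial_in_def)
  have "cofactor A i j = F (($$) A)" if "A \<in> G" for A
  proof -
    have A: "A \<in> carrier_mat n n" using G that by auto
    have "mat_delete A i j $$ (a, \<pi> a) = A $$ (insert_index i a, insert_index j (\<pi> a))"
      if "\<pi> permutes {0..<n - 1}" "a < n - 1" for \<pi> a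
      using A ij that by (subst mat_delete_index[symmetric, of A "n - 1"]) (auto dest: permutes_nat_less)
    then show ?thesis
      unfolding cofactor_def F_def
      by (subst det_def'[of _ "n - 1"]) (use A in \<open>auto intro!: sum.cong prod.cong mat_delete_carrier\<close>)
  qed
  with p show ?thesis
    unfolding regular_on_def by (intro exI[of _ p] exI[of _ 1]) auto
qed

subsection \<open>Tensor powers\<close>

text \<open>The basis tensor \<open>e(i\<^sub>0) \<otimes> \<dots> \<otimes> e(i\<^sub>k\<^sub>-\<^sub>1)\<close> is indexed by the number with base-\<open>n\<close> digits \<open>i\<^sub>l\<close>.\<close>

definition digit :: "nat \<Rightarrow> nat \<Rightarrow> nat \<Rightarrow> nat" where
  "digit n l i = i div n ^ l mod n"

lemma digit_less: "i < n ^ k \<Longrightarrow> l < k \<Longrightarrow> digit n l i < n"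
  by (cases "n = 0") (auto simp: digit_def power_0_left split: if_splits)

lemma digit_0: "digit n 0 i = i mod n"
  by (simp add: digit_def)

lemma digit_Suc: "digit n (Suc l) i = digit n l (i div n)"
  by (simp add: digit_def div_mult2_eq)

lemma digit_inject:
  assumes "i < n ^ k" "j < n ^ k" "\<And>l. l < k \<Longrightarrow> digit n l i = digit n l j"
  shows "i = j"
  using assms
proof (induction k arbitrary: i j)
  case (Suc k)
  have "i div n = j div n"
  proof (rule Suc.IH)
    show "i div n < n ^ k" "j div n < n ^ k"
      using Suc.prems(1,2) by (simp_all add: less_mult_imp_div_less mult.commute)
  qed (use Suc.prems(3) in \<open>auto simp flip: digit_Suc\<close>)
  moreover have "i mod n = j mod n"
    using Suc.prems(3)[of 0] by (simp add: digit_0)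
  ultimately show ?case by (metis div_mult_mod_eq)
qed auto

lemma sum_div_mod:
  fixes f :: "nat \<Rightarrow> nat \<Rightarrow> 'a::comm_monoid_add"
  shows "(\<Sum>i<n * m. f (i div n) (i mod n)) = (\<Sum>j<m. \<Sum>a<n. f j a)"
proof -
  have "(\<Sum>i<n * m. f (i div n) (i mod n)) = (\<Sum>(j, a)\<in>{..<m} \<times> {..<n}. f j a)"
  proof (rule sum.reindex_bij_witness[where i = "\<lambda>(j, a). j * n + a" and j = "\<lambda>i. (i div n, i mod n)"])
    fix b assume "b \<in> {..<m} \<times> {..<n}"
    then obtain j a where b: "b = (j, a)" "j < m" "a < n" by auto
    then have "Suc j * n \<le> m * n" by (intro mult_le_mono1) auto
    with b show "(case b of (j, a) \<Rightarrow> j * n + a) \<in> {..<n * m}" by (simp add: mult.commute)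
  qed (auto simp: less_mult_imp_div_less mult.commute intro!: mod_less_divisor gr0I)
  then show ?thesis by (simp add: sum.cartesian_product)
qed

text \<open>The distributive law: the numbers below \<open>n ^ k\<close> run through all k-tuples of
  digits, that is, through all choices of one summand from each factor. The multiplicativity of
  tensor powers rests on it.\<close>

lemma sum_prod_digits:
  fixes f :: "nat \<Rightarrow> nat \<Rightarrow> 'a::comm_semiring_1"
  shows "(\<Sum>i<n ^ k. \<Prod>l<k. f l (digit n l i)) = (\<Prod>l<k. \<Sum>a<n. f l a)"
proof (induction k arbitrary: f)
  case (Suc k)
  \<comment> \<open>The lowest digit is split off: it is \<open>i mod n\<close>, and the remaining
    digits are those of \<open>i div n\<close>.\<close>
  have "(\<Sum>i<n ^ Suc k. \<Prod>l<Suc k. f l (digit n l i))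
      = (\<Sum>i<n * n ^ k. f 0 (i mod n) * (\<Prod>l<k. f (Suc l) (digit n l (i div n))))"
    by (simp add: prod.lessThan_Suc_shift digit_0 digit_Suc del: prod.lessThan_Suc)
  also have "\<dots> = (\<Sum>j<n ^ k. \<Sum>a<n. f 0 a * (\<Prod>l<k. f (Suc l) (digit n l j)))"
    by (rule sum_div_mod)
  also have "\<dots> = (\<Sum>a<n. f 0 a) * (\<Sum>j<n ^ k. \<Prod>l<k. f (Suc l) (digit n l j))"
    by (simp add: sum_product sum.swap[of _ "{..<n ^ k}"])
  also have "\<dots> = (\<Prod>l<Suc k. \<Sum>a<n. f l a)"
    by (simp add: Suc.IH[of "\<lambda>l. f (Suc l)"] prod.lessThan_Suc_shift del: prod.lessThan_Suc)
  finally show ?case .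
qed simp

text \<open>The k-th Kronecker power, i.e. the matrix of the k-th tensor power of A in the basis of
  pure basis tensors.\<close>

definition tensor_mat :: "nat \<Rightarrow> nat \<Rightarrow> 'k::comm_ring_1 mat \<Rightarrow> 'k mat" where
  "tensor_mat n k A =
     mat (n ^ k) (n ^ k) (\<lambda>(i, j). \<Prod>l<k. A $$ (digit n l i, digit n l j))"

definition tensor_vec :: "nat \<Rightarrow> nat \<Rightarrow> 'k::comm_ring_1 vec \<Rightarrow> 'k vec" where
  "tensor_vec n k x = vec (n ^ k) (\<lambda>i. \<Prod>l<k. x $ digit n l i)"

lemma tensor_mat_carrier [simp]: "tensor_mat n k A \<in> carrier_mat (n ^ k) (n ^ k)"
  and tensor_vec_carrier [simp]: "tensor_vec n k x \<in> carrier_vec (n ^ k)"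
  by (auto simp: tensor_mat_def tensor_vec_def)

lemma tensor_mat_mult:
  assumes "A \<in> carrier_mat n n" "B \<in> carrier_mat n n"
  shows "tensor_mat n k (A * B) = tensor_mat n k A * tensor_mat n k B"
proof (rule eq_matI)
  fix i j assume "i < dim_row (tensor_mat n k A * tensor_mat n k B)"
    "j < dim_col (tensor_mat n k A * tensor_mat n k B)"
  then have ij: "i < n ^ k" "j < n ^ k" by (auto simp: tensor_mat_def)
  have "tensor_mat n k (A * B) $$ (i, j)
      = (\<Prod>l<k. \<Sum>a<n. A $$ (digit n l i, a) * B $$ (a, digit n l j))"
    using ij assms digit_less[OF ij(1)] digit_less[OF ij(2)]
    by (auto simp: tensor_mat_def scalar_prod_def atLeast0LessThan intro!: prod.cong sum.cong)
  also have "\<dots> = (\<Sum>c<n ^ k. \<Prod>l<k. A $$ (digit n l i, digit n l c) * B $$ (digit n l c, digit n l j))"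
    by (rule sum_prod_digits[symmetric])
  also have "\<dots> = (tensor_mat n k A * tensor_mat n k B) $$ (i, j)"
    using ij by (simp add: tensor_mat_def scalar_prod_def atLeast0LessThan prod.distrib)
  finally show "tensor_mat n k (A * B) $$ (i, j) = (tensor_mat n k A * tensor_mat n k B) $$ (i, j)" .
qed (auto simp: tensor_mat_def)

lemma tensor_mat_mult_tensor_vec:
  assumes "A \<in> carrier_mat n n" "x \<in> carrier_vec n"
  shows "tensor_mat n k A *\<^sub>v tensor_vec n k x = tensor_vec n k (A *\<^sub>v x)"
proof (rule eq_vecI)
  fix i assume "i < dim_vec (tensor_vec n k (A *\<^sub>v x))"
  then have i: "i < n ^ k" by (auto simp: tensor_vec_def)
  have "tensor_vec n k (A *\<^sub>v x) $ i = (\<Prod>l<k. \<Sum>a<n. A $$ (digit n l i, a) * x $ a)"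
    using i assms digit_less[OF i]
    by (auto simp: tensor_vec_def scalar_prod_def atLeast0LessThan intro!: prod.cong sum.cong)
  also have "\<dots> = (\<Sum>c<n ^ k. \<Prod>l<k. A $$ (digit n l i, digit n l c) * x $ digit n l c)"
    by (rule sum_prod_digits[symmetric])
  also have "\<dots> = (tensor_mat n k A *\<^sub>v tensor_vec n k x) $ i"
    using i by (simp add: tensor_mat_def tensor_vec_def scalar_prod_def atLeast0LessThan prod.distrib)
  finally show "(tensor_mat n k A *\<^sub>v tensor_vec n k x) $ i = tensor_vec n k (A *\<^sub>v x) $ i" ..
qed (auto simp: tensor_mat_def tensor_vec_def)

lemma scalar_prod_tensor_vec:
  assumes "x \<in> carrier_vec n" "y \<in> carrier_vec n"
  shows "tensor_vec n k x \<bullet> tensor_vec n k y = (x \<bullet> y) ^ k"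
proof -
  have "tensor_vec n k x \<bullet> tensor_vec n k y
      = (\<Sum>c<n ^ k. \<Prod>l<k. x $ digit n l c * y $ digit n l c)"
    by (simp add: tensor_vec_def scalar_prod_def atLeast0LessThan prod.distrib)
  also have "\<dots> = (\<Prod>l<k. \<Sum>a<n. x $ a * y $ a)"
    by (rule sum_prod_digits)
  also have "\<dots> = (x \<bullet> y) ^ k"
    using assms by (simp add: scalar_prod_def atLeast0LessThan)
  finally show ?thesis .
qed

lemma tensor_vec_smult:
  assumes "x \<in> carrier_vec n"
  shows "tensor_vec n k (c \<cdot>\<^sub>v x) = c ^ k \<cdot>\<^sub>v tensor_vec n k x"
  using assms digit_less by (auto simp: tensor_vec_def vec_eq_iff prod.distrib)

lemma tensor_mat_one: "tensor_mat n k (1\<^sub>m n) = 1\<^sub>m (n ^ k)"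
proof (rule eq_matI)
  fix i j assume "i < dim_row (1\<^sub>m (n ^ k) :: 'a mat)" "j < dim_col (1\<^sub>m (n ^ k) :: 'a mat)"
  then have ij: "i < n ^ k" "j < n ^ k" by auto
  have "tensor_mat n k (1\<^sub>m n :: 'a mat) $$ (i, j)
      = (\<Prod>l<k. if digit n l i = digit n l j then 1 else 0)"
    using ij digit_less[OF ij(1)] digit_less[OF ij(2)] by (auto simp: tensor_mat_def intro!: prod.cong)
  also have "\<dots> = (if i = j then 1 else 0)"
  proof (cases "i = j")
    \<comment> \<open>Distinct indices differ in some digit, and that digit contributes a zero
      factor.\<close>
    case False
    then obtain l where "l < k" "digit n l i \<noteq> digit n l j"
      using digit_inject[OF ij] by blast
    with False show ?thesis by (auto intro!: prod_zero bexI[of _ l])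
  qed simp
  finally show "tensor_mat n k (1\<^sub>m n) $$ (i, j) = (1\<^sub>m (n ^ k) :: 'a mat) $$ (i, j)"
    using ij by simp
qed (auto simp: tensor_mat_def)

lemma transpose_tensor_mat:
  assumes "A \<in> carrier_mat n n"
  shows "transpose_mat (tensor_mat n k A) = tensor_mat n k (transpose_mat A)"
  using assms digit_less
  by (auto simp: tensor_mat_def mat_eq_iff intro!: prod.cong)

subsection \<open>Weight vectors of a torus\<close>

text \<open>Write E for the matrix of i-th coefficients. In M(s) M(t) = M(s t), comparing
  coefficients in one parameter gives E M(t) = t^i E and M(t) E = t^i E; comparing coefficients of
  t^i in the first of these gives E E = E.\<close>

lemma multiplicative_poly_matrix_coeff:
  fixes M :: "nat \<Rightarrow> nat \<Rightarrow> 'k::alg_closed_field poly"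
  assumes mult: "\<And>a b s t. a < n \<Longrightarrow> b < n \<Longrightarrow> s \<noteq> 0 \<Longrightarrow> t \<noteq> 0 \<Longrightarrow>
      (\<Sum>c<n. poly (M a c) s * poly (M c b) t) = poly (M a b) (s * t)"
    and ab: "a < n" "b < n"
  shows "t \<noteq> 0 \<Longrightarrow> (\<Sum>c<n. coeff (M a c) i * poly (M c b) t) = coeff (M a b) i * t ^ i"
    and "t \<noteq> 0 \<Longrightarrow> (\<Sum>c<n. poly (M a c) t * coeff (M c b) i) = coeff (M a b) i * t ^ i"
    and "(\<Sum>c<n. coeff (M a c) i * coeff (M c b) i) = coeff (M a b) i"
proof -
  show left: "(\<Sum>c<n. coeff (M a c) i * poly (M c b) t) = coeff (M a b) i * t ^ i" if "t \<noteq> 0" for t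
  proof -
    \<comment> \<open>Here \<open>t\<close> is fixed and both sides are polynomials in s;
      composition with \<open>[:0, t:]\<close> turns M(s) into M(s t).\<close>
    have "coeff (\<Sum>c<n. smult (poly (M c b) t) (M a c)) i = coeff (pcompose (M a b) [:0, t:]) i"
      by (rule coeff_eq_if_poly_eq_nonzero)
         (use mult[OF ab _ that] in \<open>simp add: poly_sum poly_pcompose mult_ac\<close>)
    then show ?thesis by (simp add: coeff_sum coeff_pcompose_linear mult_ac)
  qed
  show "(\<Sum>c<n. poly (M a c) t * coeff (M c b) i) = coeff (M a b) i * t ^ i" if "t \<noteq> 0"
  proof -
    have "coeff (\<Sum>c<n. smult (poly (M a c) t) (M c b)) i = coeff (pcompose (M a b) [:0, t:]) i"
      by (rule coeff_eq_if_poly_eq_nonzero)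
         (use mult[OF ab that] in \<open>simp add: poly_sum poly_pcompose mult_ac\<close>)
    then show ?thesis by (simp add: coeff_sum coeff_pcompose_linear mult_ac)
  qed
  have "coeff (\<Sum>c<n. smult (coeff (M a c) i) (M c b)) i = coeff (monom (coeff (M a b) i) i) i"
    by (rule coeff_eq_if_poly_eq_nonzero) (simp add: poly_sum poly_monom left)
  then show "(\<Sum>c<n. coeff (M a c) i * coeff (M c b) i) = coeff (M a b) i"
    by (simp add: coeff_sum)
qed

text \<open>This solves t^(i - j) = s for a possibly negative exponent by extracting a root of s or
  of its inverse. It shows that a nontrivial weight takes every nonzero value.\<close>

lemma ex_root_quotient:
  fixes s :: "'k::alg_closed_field"
  assumes "s \<noteq> 0" "i \<noteq> j"
  shows "\<exists>t. t \<noteq> 0 \<and> t ^ i = s * t ^ j"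
proof (cases "j < i")
  case True
  then obtain t where t: "t ^ (i - j) = s" using nth_root_exists[of "i - j" s] by auto
  then have "t ^ i = s * t ^ j" using True by (metis less_imp_le_nat le_add_diff_inverse2 power_add)
  moreover have "t \<noteq> 0" using t assms True by auto
  ultimately show ?thesis by blast
next
  case False
  with assms have ij: "i < j" by simp
  then obtain t where t: "t ^ (j - i) = inverse s"
    using nth_root_exists[of "j - i" "inverse s"] by auto
  have "t ^ j = t ^ (j - i) * t ^ i" using ij by (simp flip: power_add)
  then have "t ^ i = s * t ^ j" using t assms by simp
  moreover have "t \<noteq> 0" using t assms ij by (auto simp: power_0_left)
  ultimately show ?thesis by blast
qed

text \<open>\<open>multrow_mat r 0 t\<close> is diag(t, 1, ..., 1), so these matrices form a
  one-parameter subgroup of the diagonal torus.\<close>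

lemma multrow_mat_mult:
  "0 < r \<Longrightarrow> multrow_mat r 0 s * multrow_mat r 0 t = (multrow_mat r 0 (s * t) :: 'k::field mat)"
  by (subst multrow_mat[symmetric, of _ r r]) (auto simp: mat_eq_iff)

lemma multrow_mat_diagonal_group:
  "0 < r \<Longrightarrow> t \<noteq> 0 \<Longrightarrow> multrow_mat r 0 t \<in> diagonal_group r"
  by (auto simp: diagonal_group_def carrier_GL det_multrow_mat diagonal_mat_def)

lemma mult_GL: "mult (GL n) = (*)" and one_GL: "one (GL n) = 1\<^sub>m n"
  by (simp_all add: GL_def units_of_def ring_mat_simps)

lemma torus_weight_vectors:
  fixes T :: "'k::alg_closed_field mat set"
  assumes torus: "is_torus n T" and nontriv: "T \<noteq> {1\<^sub>m n}"
  obtains u l where "u \<in> carrier_vec n" "l \<in> carrier_vec n" "u \<bullet> l \<noteq> 0"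
    "\<And>s. s \<noteq> 0 \<Longrightarrow> \<exists>A\<in>T. A *\<^sub>v u = s \<cdot>\<^sub>v u \<and> transpose_mat A *\<^sub>v l = s \<cdot>\<^sub>v l"
proof -
  obtain r \<phi> \<psi> where hom: "algebraic_group_hom n T r (diagonal_group r) \<phi>"
      "algebraic_group_hom r (diagonal_group r) n T \<psi>"
    and inv: "\<And>A. A \<in> T \<Longrightarrow> \<psi> (\<phi> A) = A" "\<And>B. B \<in> diagonal_group r \<Longrightarrow> \<phi> (\<psi> B) = B"
    and sub: "subgroup T (GL n)"
    using torus
    by (auto simp: is_torus_def algebraic_group_isomorphic_def linear_algebraic_group_def)
  have \<phi>: "\<phi> A \<in> diagonal_group r" if "A \<in> T" for A
    using hom(1) that by (auto simp: algebraic_group_hom_def hom_def)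
  have \<psi>: "\<psi> B \<in> T" if "B \<in> diagonal_group r" for B
    using hom(2) that by (auto simp: algebraic_group_hom_def hom_def)
  have \<psi>_mult: "\<psi> (B * C) = \<psi> B * \<psi> C" if "B \<in> diagonal_group r" "C \<in> diagonal_group r" for B C
    using hom(2) that by (auto simp: algebraic_group_hom_def hom_def mult_GL)
  have T: "T \<subseteq> carrier_mat n n" and one: "1\<^sub>m n \<in> T"
    using subgroup.subset[OF sub] subgroup.one_closed[OF sub] by (auto simp: carrier_GL one_GL)
  \<comment> \<open>For r = 0 the diagonal group has a single element, so the isomorphism would make
    T trivial.\<close>
  have r: "0 < r"
  proof (rule ccontr)
    assume "\<not> 0 < r"
    then have "\<phi> A = \<phi> (1\<^sub>m n)" if "A \<in> T" for A
      using \<phi>[OF that] \<phi>[OF one] by (auto simp: diagonal_group_def carrier_GL)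
    then have "A = 1\<^sub>m n" if "A \<in> T" for A using inv(1) that one by metis
    then have "T = {1\<^sub>m n}" using one by blast
    with nontriv show False by simp
  qed
  \<comment> \<open>An injective one-parameter subgroup of T.\<close>
  define L where "L t = \<psi> (multrow_mat r 0 t)" for t
  have LT: "L t \<in> T" if "t \<noteq> 0" for t
    unfolding L_def using that r by (intro \<psi> multrow_mat_diagonal_group)
  then have L: "L t \<in> carrier_mat n n" if "t \<noteq> 0" for t using that T by blast
  have L_mult: "L (s * t) = L s * L t" if "s \<noteq> 0" "t \<noteq> 0" for s t
    unfolding L_def using that r
    by (subst multrow_mat_mult[symmetric]) (auto intro!: \<psi>_mult multrow_mat_diagonal_group)
  have L_inj: "s = t" if "s \<noteq> 0" "t \<noteq> 0" "L s = L t" for s t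
  proof -
    have "multrow_mat r 0 s = multrow_mat r 0 t"
      using inv(2)[OF multrow_mat_diagonal_group[OF r that(1)]]
        inv(2)[OF multrow_mat_diagonal_group[OF r that(2)]] that(3)[unfolded L_def] by metis
    then have "multrow_mat r 0 s $$ (0, 0) = multrow_mat r 0 t $$ (0, 0)" by simp
    with r show ?thesis by simp
  qed
  have "\<exists>P N. \<forall>t. t \<noteq> 0 \<longrightarrow> L t $$ (a, b) = poly P t / t ^ N" if ab: "a < n" "b < n" for a b
  proof -
    obtain p N where p: "mpoly_vars p \<subseteq> {..<r} \<times> {..<r}"
      "\<And>B. B \<in> diagonal_group r \<Longrightarrow> \<psi> B $$ (a, b) = mpoly_eval (($$) B) p / det B ^ N"
      using hom(2) ab unfolding algebraic_group_hom_def regular_on_def by metis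
    \<comment> \<open>The entries of diag(t, 1, ..., 1) as polynomials in t.\<close>
    define q :: "nat \<times> nat \<Rightarrow> 'k poly" where
      "q = (\<lambda>(i, j). if i = 0 \<and> j = 0 then [:0, 1:] else if i = j then 1 else 0)"
    obtain P where P: "\<And>t. poly P t = mpoly_eval (\<lambda>i. poly (q i) t) p"
      using mpoly_eval_poly by metis
    have "L t $$ (a, b) = poly P t / t ^ N" if "t \<noteq> 0" for t
    proof -
      have "mpoly_eval (($$) (multrow_mat r 0 t)) p = poly P t"
        unfolding P using p(1) by (intro mpoly_eval_cong) (auto simp: q_def)
      with p(2)[OF multrow_mat_diagonal_group[OF r that]] r show ?thesis
        by (simp add: L_def det_multrow_mat)
    qed
    then show ?thesis by blast
  qed
  then obtain P N where PN: "\<And>a b t. a < n \<Longrightarrow> b < n \<Longrightarrow> t \<noteq> 0 \<Longrightarrow>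
      L t $$ (a, b) = poly (P a b) t / t ^ N a b"
    by metis
  \<comment> \<open>A common denominator exponent, at least as large as each \<open>N a b\<close>;
    thus M(t) = t^w L(t) has polynomial entries.\<close>
  define w where "w = (\<Sum>a<n. \<Sum>b<n. N a b)"
  define M where "M a b = monom 1 (w - N a b) * P a b" for a b
  have M: "poly (M a b) t = t ^ w * L t $$ (a, b)" if "a < n" "b < n" "t \<noteq> 0" for a b t
  proof -
    have "N a b \<le> (\<Sum>b<n. N a b)" using that by (intro member_le_sum) auto
    also have "\<dots> \<le> w" unfolding w_def using that
      by (intro member_le_sum[of a _ "\<lambda>a. \<Sum>b<n. N a b"]) auto
    finally have "t ^ w = t ^ (w - N a b) * t ^ N a b" by (simp flip: power_add)
    with that show ?thesis by (simp add: M_def PN poly_monom)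
  qed
  have M_mult: "(\<Sum>c<n. poly (M a c) s * poly (M c b) t) = poly (M a b) (s * t)"
    if "a < n" "b < n" "s \<noteq> 0" "t \<noteq> 0" for a b s t
  proof -
    have "L (s * t) $$ (a, b) = (\<Sum>c<n. L s $$ (a, c) * L t $$ (c, b))"
      using that L[of s] L[of t] by (simp add: L_mult scalar_prod_def atLeast0LessThan)
    with that show ?thesis
      by (simp add: M sum_distrib_left power_mult_distrib mult_ac)
  qed
  note E = multiplicative_poly_matrix_coeff[of n M, OF M_mult]
  \<comment> \<open>The coefficient of t^i in M belongs to weight i - w of L. If only weight 0
    occurred, L would be constant, contradicting injectivity over an infinite field.\<close>
  have "\<exists>i a b. i \<noteq> w \<and> a < n \<and> b < n \<and> coeff (M a b) i \<noteq> 0"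
  proof (rule ccontr)
    assume *: "\<nexists>i a b. i \<noteq> w \<and> a < n \<and> b < n \<and> coeff (M a b) i \<noteq> 0"
    have "L t $$ (a, b) = coeff (M a b) w" if "a < n" "b < n" "t \<noteq> 0" for a b t
    proof -
      have "M a b = monom (coeff (M a b) w) w"
        using * that by (auto simp: poly_eq_iff)
      then have "poly (M a b) t = coeff (M a b) w * t ^ w" by (metis poly_monom)
      with M[OF that] that show ?thesis by simp
    qed
    then have const: "L t = L 1" if "t \<noteq> 0" for t
      using L[OF that] L[of 1] that by (intro eq_matI) auto
    have "t = 1" if "t \<noteq> 0" for t :: 'k
      by (rule L_inj[OF that _ const[OF that]]) simp
    then have "UNIV \<subseteq> {0, 1 :: 'k}" by auto
    then show False using infinite_UNIV_alg_closed[where 'k = 'k] finite_subset by blast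
  qed
  then obtain i a b where i: "i \<noteq> w" and ab: "a < n" "b < n" and nz: "coeff (M a b) i \<noteq> 0"
    by blast
  \<comment> \<open>Column \<open>b\<close> and row \<open>a\<close> of the idempotent coefficient
    matrix; their pairing is its entry at (a, b), which is nonzero.\<close>
  define u where "u = vec n (\<lambda>c. coeff (M c b) i)"
  define l where "l = vec n (\<lambda>c. coeff (M a c) i)"
  show thesis
  proof (rule that[of u l])
    show "u \<bullet> l \<noteq> 0"
      using E(3)[OF _ _ _ _ ab, of i] nz by (simp add: u_def l_def scalar_prod_def atLeast0LessThan mult.commute)
  next
    fix s :: 'k assume s: "s \<noteq> 0"
    \<comment> \<open>Both vectors have weight i - w under L, so t is chosen with t^(i - w) =
      s.\<close>
    then obtain t where t: "t \<noteq> 0" "t ^ i = s * t ^ w" using ex_root_quotient[OF s i] by blast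
    have "L t *\<^sub>v u = s \<cdot>\<^sub>v u"
    proof (rule eq_vecI)
      fix c assume "c < dim_vec (s \<cdot>\<^sub>v u)"
      then have c: "c < n" by (simp add: u_def)
      have "t ^ w * (L t *\<^sub>v u) $ c = (\<Sum>d<n. poly (M c d) t * coeff (M d b) i)"
        using c L[OF t(1)]
        by (simp add: u_def scalar_prod_def atLeast0LessThan sum_distrib_left M t mult.assoc)
      also have "\<dots> = t ^ w * (s * coeff (M c b) i)"
        using E(2)[OF _ _ _ _ c ab(2) t(1), of i] t by simp
      finally show "(L t *\<^sub>v u) $ c = (s \<cdot>\<^sub>v u) $ c" using c t by (simp add: u_def)
    qed (use L[OF t(1)] in \<open>auto simp: u_def\<close>)
    moreover have "transpose_mat (L t) *\<^sub>v l = s \<cdot>\<^sub>v l"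
    proof (rule eq_vecI)
      fix c assume "c < dim_vec (s \<cdot>\<^sub>v l)"
      then have c: "c < n" by (simp add: l_def)
      have "t ^ w * (transpose_mat (L t) *\<^sub>v l) $ c = (\<Sum>d<n. coeff (M a d) i * poly (M d c) t)"
        using c L[OF t(1)]
        by (simp add: l_def scalar_prod_def atLeast0LessThan sum_distrib_left M t mult_ac)
      also have "\<dots> = t ^ w * (s * coeff (M a c) i)"
        using E(1)[OF _ _ _ _ ab(1) c t(1), of i] t by simp
      finally show "(transpose_mat (L t) *\<^sub>v l) $ c = (s \<cdot>\<^sub>v l) $ c" using c t by (simp add: l_def)
    qed (use L[OF t(1)] in \<open>auto simp: l_def\<close>)
    ultimately show "\<exists>A\<in>T. A *\<^sub>v u = s \<cdot>\<^sub>v u \<and> transpose_mat A *\<^sub>v l = s \<cdot>\<^sub>v l"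
      using LT[OF t(1)] by blast
  qed (auto simp: u_def l_def)
qed

subsection \<open>The module \<open>U \<oplus> (U\<^sup>*)\<^bsup>\<otimes>k\<^esup>\<close>\<close>

lemma inv_GL:
  assumes "A \<in> carrier (GL n)"
  shows "inv\<^bsub>GL n\<^esub> A \<in> carrier (GL n)" "inv\<^bsub>GL n\<^esub> A \<in> carrier_mat n n"
    "A * inv\<^bsub>GL n\<^esub> A = 1\<^sub>m n" "inv\<^bsub>GL n\<^esub> A * A = 1\<^sub>m n"
proof -
  interpret group "GL n :: 'a mat monoid" by (rule group_GL)
  show inv: "inv\<^bsub>GL n\<^esub> A \<in> carrier (GL n)" using assms by simp
  then show "inv\<^bsub>GL n\<^esub> A \<in> carrier_mat n n" by (simp add: carrier_GL)
  show "A * inv\<^bsub>GL n\<^esub> A = 1\<^sub>m n" "inv\<^bsub>GL n\<^esub> A * A = 1\<^sub>m n"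
    using r_inv[OF assms] l_inv[OF assms] by (simp_all add: mult_GL one_GL)
qed

lemma inv_GL_eq_adj_mat:
  assumes "A \<in> carrier (GL n)"
  shows "inv\<^bsub>GL n\<^esub> A = inverse (det A) \<cdot>\<^sub>m adj_mat A"
proof -
  have A: "A \<in> carrier_mat n n" "det A \<noteq> 0" using assms by (auto simp: carrier_GL)
  have "inv\<^bsub>GL n\<^esub> A = (inverse (det A) \<cdot>\<^sub>m adj_mat A) * (A * inv\<^bsub>GL n\<^esub> A)"
  proof -
    have "(inverse (det A) \<cdot>\<^sub>m adj_mat A) * A = 1\<^sub>m n"
      using A adj_mat[OF A(1)] by (auto simp: mult_smult_assoc_mat[of _ n n _ n] mat_eq_iff)
    then show ?thesis
      using A adj_mat[OF A(1)] inv_GL[OF assms]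
      by (subst assoc_mult_mat[symmetric, of _ n n _ n _ n]) auto
  qed
  then show ?thesis using A adj_mat(1)[OF A(1)] inv_GL[OF assms] by simp
qed

text \<open>In the dual basis A acts on the dual of U by its inverse transpose; the lower block is
  the k-th tensor power of that action.\<close>

definition pairing_rep :: "nat \<Rightarrow> nat \<Rightarrow> 'k::field mat \<Rightarrow> 'k mat" where
  "pairing_rep n k A = four_block_mat A (0\<^sub>m n (n ^ k)) (0\<^sub>m (n ^ k) n)
     (tensor_mat n k (transpose_mat (inv\<^bsub>GL n\<^esub> A)))"

lemma pairing_rep_carrier_mat:
  "A \<in> carrier_mat n n \<Longrightarrow> pairing_rep n k A \<in> carrier_mat (n + n ^ k) (n + n ^ k)"
  by (simp add: pairing_rep_def)

lemma pairing_rep_mult: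
  assumes "A \<in> carrier (GL n)" "B \<in> carrier (GL n)"
  shows "pairing_rep n k (A * B) = pairing_rep n k A * pairing_rep n k B"
proof -
  interpret group "GL n :: 'a mat monoid" by (rule group_GL)
  let ?K = "\<lambda>A. tensor_mat n k (transpose_mat (inv\<^bsub>GL n\<^esub> A))"
  have c: "A \<in> carrier_mat n n" "B \<in> carrier_mat n n" using assms by (auto simp: carrier_GL)
  \<comment> \<open>Inversion and transposition both reverse products, so together they preserve the
    order.\<close>
  have "inv\<^bsub>GL n\<^esub> (A * B) = inv\<^bsub>GL n\<^esub> B * inv\<^bsub>GL n\<^esub> A"
    using inv_mult_group[OF assms] by (simp add: mult_GL)
  then have "?K (A * B) = ?K A * ?K B"
    using inv_GL(2)[OF assms(1)] inv_GL(2)[OF assms(2)]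
    by (simp add: transpose_mult[of _ n n _ n] tensor_mat_mult)
  moreover note left_mult_zero_mat[of "?K B" "n ^ k" "n ^ k" n]
    right_mult_zero_mat[of "?K A" "n ^ k" "n ^ k" n]
    left_add_zero_mat[OF mult_carrier_mat[of "?K A" "n ^ k" "n ^ k" "?K B" "n ^ k"]]
  ultimately show ?thesis
    unfolding pairing_rep_def
    by (subst mult_four_block_mat[of _ n n _ "n ^ k" _ "n ^ k" _ _ n _ "n ^ k"]) (use c in auto)
qed

lemma pairing_rep_one: "pairing_rep n k (1\<^sub>m n) = 1\<^sub>m (n + n ^ k)"
proof -
  interpret group "GL n :: 'a mat monoid" by (rule group_GL)
  show ?thesis
    using inv_one by (simp add: pairing_rep_def one_GL tensor_mat_one)
qed

text \<open>The image of the inverse is an inverse of the image, so the determinant is a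
  unit.\<close>

lemma pairing_rep_carrier_GL:
  assumes "A \<in> carrier (GL n)"
  shows "pairing_rep n k A \<in> carrier (GL (n + n ^ k))"
proof -
  have c: "A \<in> carrier_mat n n" using assms by (auto simp: carrier_GL)
  have "pairing_rep n k A * pairing_rep n k (inv\<^bsub>GL n\<^esub> A) = 1\<^sub>m (n + n ^ k)"
    using pairing_rep_mult[OF assms inv_GL(1)[OF assms]] inv_GL(3)[OF assms]
    by (simp add: pairing_rep_one)
  then have "det (pairing_rep n k A) * det (pairing_rep n k (inv\<^bsub>GL n\<^esub> A)) = 1"
    using pairing_rep_carrier_mat[OF c] pairing_rep_carrier_mat[OF inv_GL(2)[OF assms]]
    by (metis det_mult det_one)
  then show ?thesis
    using pairing_rep_carrier_mat[OF c] by (auto simp: carrier_GL)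
qed

text \<open>Every matrix entry is an entry of A, zero, or a product of k entries of the inverse
  transpose; the latter are cofactors divided by the determinant.\<close>

lemma is_module_pairing_rep:
  assumes G: "G \<subseteq> carrier (GL n)"
  shows "is_module n G (n + n ^ k) (pairing_rep n k)"
proof -
  have c: "A \<in> carrier_mat n n" if "A \<in> G" for A using G that by (auto simp: carrier_GL)
  have inv_reg: "regular_on n G (\<lambda>A. transpose_mat (inv\<^bsub>GL n\<^esub> A) $$ (i, j))" if "i < n" "j < n" for i j
  proof (rule regular_on_cong[OF _ regular_on_cofactor_div_det[of G n i j]])
    fix A assume A: "A \<in> G"
    then have "transpose_mat (inv\<^bsub>GL n\<^esub> A) $$ (i, j) = (inverse (det A) \<cdot>\<^sub>m adj_mat A) $$ (j, i)"
      using that G c[OF A] by (subst inv_GL_eq_adj_mat) (auto simp: adj_mat_def)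
    then show "cofactor A i j / det A = transpose_mat (inv\<^bsub>GL n\<^esub> A) $$ (i, j)"
      using c[OF A] that by (simp add: adj_mat_def divide_inverse mult.commute)
  qed (use that c in auto)
  have "regular_on n G (\<lambda>A. pairing_rep n k A $$ (i, j))" if ij: "i < n + n ^ k" "j < n + n ^ k" for i j
  proof -
    define f where "f A = (if i < n then if j < n then A $$ (i, j) else 0
        else if j < n then 0
        else \<Prod>l<k. transpose_mat (inv\<^bsub>GL n\<^esub> A) $$ (digit n l (i - n), digit n l (j - n)))"
      for A :: "'a mat"
    have dims: "dim_row A = n" "dim_col A = n" if "A \<in> G" for A using c[OF that] by auto
    have "f A = pairing_rep n k A $$ (i, j)" if "A \<in> G" for A
      using ij dims[OF that] by (auto simp: f_def pairing_rep_def tensor_mat_def)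
    moreover have "regular_on n G f"
    proof (cases "i < n \<or> j < n")
      case True
      then show ?thesis
        unfolding f_def
        by (cases "i < n"; cases "j < n") (auto intro: regular_on_const regular_on_entry)
    next
      case False
      with ij have "i - n < n ^ k" "j - n < n ^ k" by auto
      with False show ?thesis
        unfolding f_def by (auto intro!: regular_on_prod inv_reg digit_less)
    qed
    ultimately show ?thesis by (rule regular_on_cong)
  qed
  moreover have "pairing_rep n k \<in> hom (GL n\<lparr>carrier := G\<rparr>)
      (GL (n + n ^ k)\<lparr>carrier := carrier (GL (n + n ^ k))\<rparr>)"
    using G by (auto simp: hom_def mult_GL intro!: pairing_rep_carrier_GL pairing_rep_mult)
  ultimately show ?thesis by (simp add: is_module_def algebraic_group_hom_def)
qed

lemma pairing_rep_mult_vec: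
  assumes "A \<in> carrier_mat n n" "x \<in> carrier_vec n" "w \<in> carrier_vec (n ^ k)"
  shows "pairing_rep n k A *\<^sub>v (x @\<^sub>v w)
    = (A *\<^sub>v x) @\<^sub>v (tensor_mat n k (transpose_mat (inv\<^bsub>GL n\<^esub> A)) *\<^sub>v w)"
proof -
  have "0\<^sub>m n (n ^ k) *\<^sub>v w = 0\<^sub>v n" "0\<^sub>m (n ^ k) n *\<^sub>v x = 0\<^sub>v (n ^ k)"
    using assms by (auto simp: vec_eq_iff scalar_prod_def)
  moreover have "A *\<^sub>v x \<in> carrier_vec n"
    "tensor_mat n k (transpose_mat (inv\<^bsub>GL n\<^esub> A)) *\<^sub>v w \<in> carrier_vec (n ^ k)"
    using assms by (auto intro: mult_mat_vec_carrier tensor_mat_carrier)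
  ultimately show ?thesis
    unfolding pairing_rep_def
    by (subst four_block_mat_mult_vec[of _ n n _ "n ^ k" _ "n ^ k"]) (use assms in auto)
qed

text \<open>Moving the second matrix across the scalar product transposes it into the tensor power
  of the inverse of A, which cancels A.\<close>

lemma pairing_invariant:
  assumes "A \<in> carrier (GL n)" "x \<in> carrier_vec n" "w \<in> carrier_vec (n ^ k)"
  shows "tensor_vec n k (A *\<^sub>v x) \<bullet> (tensor_mat n k (transpose_mat (inv\<^bsub>GL n\<^esub> A)) *\<^sub>v w)
    = tensor_vec n k x \<bullet> w"
proof -
  let ?B = "inv\<^bsub>GL n\<^esub> A"
  have A: "A \<in> carrier_mat n n" using assms by (auto simp: carrier_GL)
  note B = inv_GL(2)[OF assms(1)]
  have "tensor_vec n k (A *\<^sub>v x) \<bullet> (tensor_mat n k (transpose_mat ?B) *\<^sub>v w)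
      = (transpose_mat (tensor_mat n k (transpose_mat ?B)) *\<^sub>v tensor_vec n k (A *\<^sub>v x)) \<bullet> w"
    using assms by (intro transpose_vec_mult_scalar[symmetric, of _ "n ^ k" "n ^ k"]) auto
  also have "transpose_mat (tensor_mat n k (transpose_mat ?B)) = tensor_mat n k ?B"
    using B by (subst transpose_tensor_mat) auto
  also have "tensor_mat n k ?B *\<^sub>v tensor_vec n k (A *\<^sub>v x) = tensor_vec n k ((?B * A) *\<^sub>v x)"
    using A B assms by (subst tensor_mat_mult_tensor_vec) auto
  also have "\<dots> = tensor_vec n k x"
    using inv_GL(4)[OF assms(1)] assms by simp
  finally show ?thesis .
qed

lemma ex_pairing_polynomial:
  obtains p :: "(nat, 'k::field) mpoly" where
    "mpoly_vars p \<subseteq> {..<n + n ^ k}" "mpoly_const_term p = 0"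
    "\<And>x w. x \<in> carrier_vec n \<Longrightarrow> w \<in> carrier_vec (n ^ k) \<Longrightarrow>
      poly_fun p (x @\<^sub>v w) = tensor_vec n k x \<bullet> w"
proof -
  \<comment> \<open>The first n variables are the coordinates of x, and variable n + i is the i-th
    coordinate of w. Each summand contains such a factor, so F vanishes at the origin even for k =
    0.\<close>
  define F :: "(nat \<Rightarrow> 'k) \<Rightarrow> 'k" where
    "F = (\<lambda>x. \<Sum>i<n ^ k. (\<Prod>l<k. x (digit n l i)) * x (n + i))"
  have "polynomial_in {..<n + n ^ k} F"
    unfolding F_def
    by (intro polynomial_in_sum polynomial_in_mult polynomial_in_prod polynomial_in_var)
       (auto intro: digit_less trans_less_add1)
  then obtain p where p: "mpoly_vars p \<subseteq> {..<n + n ^ k}" "\<And>x. F x = mpoly_eval x p"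
    by (auto simp: polynomial_in_def)
  show thesis
  proof (rule that[OF p(1)])
    show "mpoly_const_term p = 0"
      by (simp flip: mpoly_eval_0 p(2) add: F_def)
    fix x w :: "'k vec" assume xw: "x \<in> carrier_vec n" "w \<in> carrier_vec (n ^ k)"
    have dg: "digit n l i < n" if "i < n ^ k" "l < k" for i l using that by (rule digit_less)
    have "(\<Prod>l<k. (x @\<^sub>v w) $ digit n l i) * (x @\<^sub>v w) $ (n + i) = tensor_vec n k x $ i * w $ i"
      if "i < n ^ k" for i
      using xw that dg[OF that] by (simp add: tensor_vec_def trans_less_add1)
    then show "poly_fun p (x @\<^sub>v w) = tensor_vec n k x \<bullet> w"
      using xw unfolding F_def p(2)[symmetric] scalar_prod_def
      by (auto simp only: atLeast0LessThan carrier_vecD intro!: sum.cong)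
  qed
qed

subsection \<open>Invariants of low degree\<close>

text \<open>The substitution gives a monomial of bidegree \<open>(a, b)\<close> the weight \<open>a - k b\<close>, which for
  \<open>a + b \<le> k\<close> vanishes only if \<open>a = b = 0\<close>.\<close>

lemma mpoly_eval_eq_0_if_weight_invariant:
  fixes f :: "(nat, 'k::alg_closed_field) mpoly"
  assumes deg: "mpoly_degree f \<le> k" and const: "mpoly_const_term f = 0"
    and inv: "\<And>s. s \<noteq> 0 \<Longrightarrow>
      mpoly_eval (\<lambda>i. if i < n then s * v i else inverse s ^ k * v i) f = mpoly_eval v f"
  shows "mpoly_eval v f = 0"
proof -
  define a b :: "(nat \<Rightarrow>\<^sub>0 nat) \<Rightarrow> nat" where
    "a \<alpha> = (\<Sum>i\<in>Poly_Mapping.keys \<alpha> \<inter> {..<n}. Poly_Mapping.lookup \<alpha> i)" and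
    "b \<alpha> = (\<Sum>i\<in>Poly_Mapping.keys \<alpha> - {..<n}. Poly_Mapping.lookup \<alpha> i)" for \<alpha>
  have ab_sum: "a \<alpha> + b \<alpha> = (\<Sum>i\<in>Poly_Mapping.keys \<alpha>. Poly_Mapping.lookup \<alpha> i)" for \<alpha>
    unfolding a_def b_def by (rule sum.Int_Diff[symmetric]) simp
  have ab: "a \<alpha> + b \<alpha> \<le> k" if "\<alpha> \<in> Poly_Mapping.keys f" for \<alpha>
  proof -
    have "a \<alpha> + b \<alpha> \<le> mpoly_degree f"
      unfolding ab_sum mpoly_degree_def using that by (intro Max_ge) auto
    with deg show ?thesis by simp
  qed
  \<comment> \<open>Q(s) is s^(k k) times the value of f at the substituted point. The shift by k k
    makes all exponents nonnegative because b is at most k, so the natural subtraction never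
    truncates.\<close>
  define Q where "Q = (\<Sum>\<alpha>\<in>Poly_Mapping.keys f.
    monom (Poly_Mapping.lookup f \<alpha> * monomial_eval v \<alpha>) (k * k + a \<alpha> - k * b \<alpha>))"
  have "poly Q s = poly (monom (mpoly_eval v f) (k * k)) s" if s: "s \<noteq> 0" for s
  proof -
    have mon: "s ^ (k * k) * monomial_eval (\<lambda>i. if i < n then s * v i else inverse s ^ k * v i) \<alpha>
        = s ^ (k * k + a \<alpha> - k * b \<alpha>) * monomial_eval v \<alpha>"
      if \<alpha>: "\<alpha> \<in> Poly_Mapping.keys f" for \<alpha>
    proof -
      let ?K = "Poly_Mapping.keys \<alpha>" and ?e = "Poly_Mapping.lookup \<alpha>"
      have "monomial_eval (\<lambda>i. if i < n then s * v i else inverse s ^ k * v i) \<alpha>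
          = (\<Prod>i\<in>?K \<inter> {..<n}. (s * v i) ^ ?e i) * (\<Prod>i\<in>?K - {..<n}. (inverse s ^ k * v i) ^ ?e i)"
        unfolding monomial_eval_def by (subst prod.Int_Diff[of _ _ "{..<n}"]) auto
      also have "\<dots> = s ^ a \<alpha> * (inverse s ^ k) ^ b \<alpha>
          * ((\<Prod>i\<in>?K \<inter> {..<n}. v i ^ ?e i) * (\<Prod>i\<in>?K - {..<n}. v i ^ ?e i))"
        by (simp add: power_mult_distrib prod.distrib power_sum a_def b_def mult_ac)
      also have "(\<Prod>i\<in>?K \<inter> {..<n}. v i ^ ?e i) * (\<Prod>i\<in>?K - {..<n}. v i ^ ?e i) = monomial_eval v \<alpha>"
        unfolding monomial_eval_def by (rule prod.Int_Diff[symmetric]) simp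
      finally have eval: "monomial_eval (\<lambda>i. if i < n then s * v i else inverse s ^ k * v i) \<alpha>
          = s ^ a \<alpha> * inverse s ^ (k * b \<alpha>) * monomial_eval v \<alpha>"
        by (simp add: power_mult)
      have weight: "s ^ (k * k) * (s ^ a \<alpha> * inverse s ^ (k * b \<alpha>)) = s ^ (k * k + a \<alpha> - k * b \<alpha>)"
      proof -
        have "k * b \<alpha> \<le> k * k + a \<alpha>" using ab[OF \<alpha>] by (intro trans_le_add1 mult_le_mono2) simp
        then have "s ^ (k * k + a \<alpha>) = s ^ (k * k + a \<alpha> - k * b \<alpha>) * s ^ (k * b \<alpha>)"
          by (simp flip: power_add)
        with s show ?thesis by (simp add: power_add power_inverse field_simps)
      qed
      show ?thesis by (simp only: eval weight[symmetric] mult.assoc)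
    qed
    have "poly Q s = (\<Sum>\<alpha>\<in>Poly_Mapping.keys f. Poly_Mapping.lookup f \<alpha>
        * (s ^ (k * k + a \<alpha> - k * b \<alpha>) * monomial_eval v \<alpha>))"
      by (simp add: Q_def poly_sum poly_monom mult_ac)
    also have "\<dots> = s ^ (k * k) * mpoly_eval (\<lambda>i. if i < n then s * v i else inverse s ^ k * v i) f"
      unfolding mpoly_eval_alt sum_distrib_left
      by (intro sum.cong refl) (simp only: mon[symmetric] mult.left_commute)
    finally show ?thesis by (simp add: inv[OF s] poly_monom mult.commute)
  qed
  then have "coeff Q (k * k) = coeff (monom (mpoly_eval v f) (k * k)) (k * k)"
    by (rule coeff_eq_if_poly_eq_nonzero)
  moreover have "coeff Q (k * k) = 0"
  proof -
    \<comment> \<open>Exponent k k would force a = k b, hence (k + 1) b \<le> k and a = b = 0. Only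
      the constant monomial qualifies, and its coefficient is zero.\<close>
    have "k * k + a \<alpha> - k * b \<alpha> \<noteq> k * k" if \<alpha>: "\<alpha> \<in> Poly_Mapping.keys f" for \<alpha>
    proof
      assume eq: "k * k + a \<alpha> - k * b \<alpha> = k * k"
      have "k * b \<alpha> \<le> k * k" using ab[OF \<alpha>] by (intro mult_le_mono2) simp
      with eq have "a \<alpha> = k * b \<alpha>" by linarith
      with ab[OF \<alpha>] have "a \<alpha> + b \<alpha> = 0" by (cases "b \<alpha>") auto
      then have "\<alpha> = 0"
        unfolding ab_sum by (auto simp: in_keys_iff intro!: poly_mapping_eqI)
      with \<alpha> const show False by (auto simp: in_keys_iff mpoly_const_term_def)
    qed
    then show ?thesis by (simp add: Q_def coeff_sum)
  qed
  ultimately show ?thesis by simp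
qed

text \<open>The pairing keeps v = (u, l tensored k times) outside the nullcone, while the weight
  argument makes every invariant of degree at most k with zero constant term vanish at v.\<close>

lemma invariants_le_not_sigma_set:
  fixes G :: "'k::alg_closed_field mat set"
  assumes sub: "subgroup G (GL n)" and uv: "u \<in> carrier_vec n" "l \<in> carrier_vec n" "u \<bullet> l \<noteq> 0"
    and weight: "\<And>s. s \<noteq> 0 \<Longrightarrow> \<exists>A\<in>G. A *\<^sub>v u = s \<cdot>\<^sub>v u \<and> transpose_mat A *\<^sub>v l = s \<cdot>\<^sub>v l"
    and d: "d \<le> k"
  shows "\<not> sigma_set n G (n + n ^ k) (pairing_rep n k)
    (invariants_le n G (n + n ^ k) (pairing_rep n k) d)"
proof
  let ?m = "n + n ^ k" and ?\<rho> = "pairing_rep n k :: 'k mat \<Rightarrow> 'k mat"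
  interpret group "GL n :: 'k mat monoid" by (rule group_GL)
  assume \<sigma>: "sigma_set n G ?m ?\<rho> (invariants_le n G ?m ?\<rho> d)"
  have G: "A \<in> carrier (GL n)" "A \<in> carrier_mat n n" if "A \<in> G" for A
    using subgroup.subset[OF sub] that by (auto simp: carrier_GL)
  define v where "v = u @\<^sub>v tensor_vec n k l"
  have v: "v \<in> carrier_vec ?m" using uv by (simp add: v_def)
  have "v \<notin> nullcone n G ?m ?\<rho>"
  proof -
    obtain p :: "(nat, 'k) mpoly" where p: "mpoly_vars p \<subseteq> {..<?m}" "mpoly_const_term p = 0"
      "\<And>x w. x \<in> carrier_vec n \<Longrightarrow> w \<in> carrier_vec (n ^ k) \<Longrightarrow>
        poly_fun p (x @\<^sub>v w) = tensor_vec n k x \<bullet> w"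
      by (rule ex_pairing_polynomial[of n k]) (rule that)
    have "poly_fun p (?\<rho> A *\<^sub>v y) = poly_fun p y" if A: "A \<in> G" and y: "y \<in> carrier_vec ?m" for A y
    proof -
      obtain x w where xw: "y = x @\<^sub>v w" "x \<in> carrier_vec n" "w \<in> carrier_vec (n ^ k)"
        using vec_first_last_append[OF y] by (metis vec_first_carrier vec_last_carrier)
      have "A *\<^sub>v x \<in> carrier_vec n"
        "tensor_mat n k (transpose_mat (inv\<^bsub>GL n\<^esub> A)) *\<^sub>v w \<in> carrier_vec (n ^ k)"
        using G[OF A] xw by (auto intro: mult_mat_vec_carrier tensor_mat_carrier)
      with xw G[OF A] show ?thesis by (simp add: pairing_rep_mult_vec p(3) pairing_invariant)
    qed
    then have "p \<in> invariants n G ?m ?\<rho>"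
      using p(1) subgroup.m_inv_closed[OF sub]
      by (auto simp: invariants_def coord_ring_def act_fun_def)
    then have "p \<in> plus_part (invariants n G ?m ?\<rho>)"
      using p(2) by (simp add: plus_part_def)
    moreover have "poly_fun p v = (u \<bullet> l) ^ k"
      using uv by (simp add: v_def p(3) scalar_prod_tensor_vec)
    ultimately show ?thesis using uv(3) by (auto simp: nullcone_def intro!: bexI[of _ p])
  qed
  with \<sigma> v obtain f where f: "f \<in> plus_part (invariants_le n G ?m ?\<rho> d)" "poly_fun f v \<noteq> 0"
    unfolding sigma_set_def by blast
  then have f_inv: "f \<in> invariants n G ?m ?\<rho>" and vars: "mpoly_vars f \<subseteq> {..<?m}"
    and deg: "mpoly_degree f \<le> k" and const: "mpoly_const_term f = 0"
    using d by (auto simp: plus_part_def invariants_le_def invariants_def coord_ring_def)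
  have "mpoly_eval (\<lambda>i. if i < n then s * v $ i else inverse s ^ k * v $ i) f = poly_fun f v"
    if s: "s \<noteq> 0" for s
  proof -
    obtain A where A: "A \<in> G" "A *\<^sub>v u = s \<cdot>\<^sub>v u" "transpose_mat A *\<^sub>v l = s \<cdot>\<^sub>v l"
      using weight[OF s] by blast
    let ?B = "inv\<^bsub>GL n\<^esub> A"
    note B = inv_GL[OF G(1)[OF A(1)]]
    \<comment> \<open>The eigenvalue s of the transpose of A on l becomes the inverse of s for its
      inverse transpose, hence s^(-k) on the tensor power.\<close>
    have "l = transpose_mat (A * ?B) *\<^sub>v l" using B uv by simp
    also have "\<dots> = transpose_mat ?B *\<^sub>v (s \<cdot>\<^sub>v l)"
      using B(2) G(2)[OF A(1)] uv A(3) by (subst transpose_mult[of _ n n _ n]) auto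
    also have "\<dots> = s \<cdot>\<^sub>v (transpose_mat ?B *\<^sub>v l)"
      using B(2) uv by (intro mult_mat_vec) auto
    finally have "inverse s \<cdot>\<^sub>v l = inverse s \<cdot>\<^sub>v (s \<cdot>\<^sub>v (transpose_mat ?B *\<^sub>v l))" by simp
    then have l: "transpose_mat ?B *\<^sub>v l = inverse s \<cdot>\<^sub>v l"
      using s by (simp add: smult_smult_assoc)
    have "?\<rho> A *\<^sub>v v = (s \<cdot>\<^sub>v u) @\<^sub>v (inverse s ^ k \<cdot>\<^sub>v tensor_vec n k l)"
      using uv G[OF A(1)] A(2) B(2)
      by (simp add: v_def pairing_rep_mult_vec tensor_mat_mult_tensor_vec l tensor_vec_smult)
    then have coord: "(if i < n then s * v $ i else inverse s ^ k * v $ i) = (?\<rho> A *\<^sub>v v) $ i"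
      if "i < ?m" for i
      using that uv by (auto simp: v_def tensor_vec_def)
    have "mpoly_eval (\<lambda>i. if i < n then s * v $ i else inverse s ^ k * v $ i) f
        = poly_fun f (?\<rho> A *\<^sub>v v)"
      using vars by (intro mpoly_eval_cong coord) auto
    \<comment> \<open>The action on functions uses the inverse group element, so invariance is
      applied to the inverse of A.\<close>
    also have "\<dots> = act_fun n ?\<rho> ?B (poly_fun f) v"
      using inv_inv[OF G(1)[OF A(1)]] by (simp add: act_fun_def)
    also have "\<dots> = poly_fun f v"
      using f_inv v subgroup.m_inv_closed[OF sub A(1)] by (simp add: invariants_def)
    finally show ?thesis .
  qed
  with deg const have "poly_fun f v = 0" by (rule mpoly_eval_eq_0_if_weight_invariant)
  with f(2) show False by simp
qed

section \<open>Unboundedness over the family of pairing modules\<close>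

theorem proposition4p2:
  fixes n :: nat and G :: "'k::alg_closed_field mat set"
  assumes "linear_algebraic_group n G"
    and "\<exists>T. T \<subseteq> G \<and> is_torus n T \<and> T \<noteq> {1\<^sub>m n}"
  shows "sigma_group n G = \<infinity>"
proof -
  have sub: "subgroup G (GL n)" using assms(1) by (simp add: linear_algebraic_group_def)
  obtain T where T: "T \<subseteq> G" "is_torus n T" "T \<noteq> {1\<^sub>m n}" using assms(2) by blast
  obtain u l where ul: "u \<in> carrier_vec n" "l \<in> carrier_vec n" "u \<bullet> l \<noteq> 0"
    and "\<And>s. s \<noteq> 0 \<Longrightarrow> \<exists>A\<in>T. A *\<^sub>v u = s \<cdot>\<^sub>v u \<and> transpose_mat A *\<^sub>v l = s \<cdot>\<^sub>v l"
    using torus_weight_vectors[OF T(2,3)] by blast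
  then have weight: "\<And>s. s \<noteq> 0 \<Longrightarrow> \<exists>A\<in>G. A *\<^sub>v u = s \<cdot>\<^sub>v u \<and> transpose_mat A *\<^sub>v l = s \<cdot>\<^sub>v l"
    using T(1) by blast
  have bound: "enat (Suc k) \<le> sigma_group n G" for k
  proof -
    have "enat (Suc k) \<le> sigma_module n G (n + n ^ k) (pairing_rep n k)"
      unfolding sigma_module_def
      \<comment> \<open>No d \<le> k belongs to the set defining \<open>sigma_module\<close>, so all
        its members, and hence the infimum, are at least k + 1.\<close>
      by (rule Inf_greatest)
         (use invariants_le_not_sigma_set[OF sub ul weight] in \<open>force simp: not_less_eq_eq\<close>)
    also have "\<dots> \<le> sigma_group n G"
      unfolding sigma_group_def
      using is_module_pairing_rep[OF subgroup.subset[OF sub]] by (intro Sup_upper) blast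
    finally show ?thesis .
  qed
  show ?thesis
  proof (cases "sigma_group n G")
    \<comment> \<open>A finite value N contradicts the bound N + 1 obtained for k = N.\<close>
    case (enat N)
    with bound[of N] show ?thesis by simp
  qed
qed

end
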